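(* Let $m\ge 1$, let $u \in F_{USCG}(\mathbb{R}^m)\setminus\{\emptyset_{F(\mathbb{R}^m)}\}$, and let $\{u_n\}_{n=1}^\infty$ be a sequence of fuzzy sets in $F_{USC}(\mathbb{R}^m)$ which satisfies the connectedness condition. Then $H_{\rm end}(u_n,u)\to 0$ as $n\to\infty$ if and only if $\lim_{n\to\infty}^{(\Gamma)} u_n = u$.
   Context: $\mathbb{R}^m$ carries the Euclidean metric $d_m$, and $\mathbb{R}^m\times[0,1]$ carries the metric $\overline{d_m}((x,\alpha),(y,\beta)) = d_m(x,y)+|\alpha-\beta|$. A fuzzy set in $\mathbb{R}^m$ is a function $u:\mathbb{R}^m\to[0,1]$; its $\alpha$-cut is $[u]_\alpha=\{x: u(x)\ge\alpha\}$ for $\alpha\in(0,1]$ and $[u]_0=\overline{\{x:u(x)>0\}}$. $\emptyset_{F(\mathbb{R}^m)}$ is the fuzzy set that is identically $0$. $F_{USC}(\mathbb{R}^m)$ is the set of fuzzy sets $u$ with $[u]_\alpha$ closed (possibly empty) for all $\alpha\in[0,1]$ (i.e. $u$ upper semi-continuous); $F_{USCG}(\mathbb{R}^m)$ is the set of $u\in F_{USC}(\mathbb{R}^m)$ with $[u]_\alpha$ compact (possibly empty) for all $\alpha\in(0,1]$. The endograph of $u$ is ${\rm end}\,u=\{(x,t)\in\mathbb{R}^m\times[0,1]: u(x)\ge t\}$. For $r\in[0,1]$, ${\rm end}_r\,u={\rm end}\,u\cap([u]_r\times[r,1])$. Hausdorff distance (possibly $+\infty$) on nonempty closed sets: $H(U,V)=\max\{H^*(U,V),H^*(V,U)\}$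 with $H^*(U,V)=\sup_{a\in U}\inf_{b\in V}\rho(a,b)$, $\rho$ the underlying metric. For $u,v\in F_{USC}(\mathbb{R}^m)$, $H_{\rm end}(u,v)=H({\rm end}\,u,{\rm end}\,v)$, computed with $\overline{d_m}$. A sequence of sets $C_n$ in a metric space Kuratowski converges to $C$ if $C=\liminf C_n=\limsup C_n$, where $\liminf C_n$ is the set of limits of convergent sequences $\{x_n\}$ with $x_n\in C_n$ for all $n$, and $\limsup C_n$ is the set of limits of convergent sequences $\{x_{n_j}\}_j$ with $x_{n_j}\in C_{n_j}$, along some subsequence $n_1<n_2<\cdots$. For $u,u_n\in F_{USC}(\mathbb{R}^m)$, $\lim_{n\to\infty}^{(\Gamma)}u_n=u$ means that ${\rm end}\,u_n$ Kuratowski converges to ${\rm end}\,u$ in $(\mathbb{R}^m\times[0,1],\overline{d_m})$. A sequence $\{u_n\}$ in $F_{USC}(\mathbb{R}^m)$ satisfies the connectedness condition if for each $\varepsilon>0$ there are $\delta\in(0,\varepsilon]$ and $N\in\mathbb{N}$ such that for all $n\ge N$, ${\rm end}_\delta\,u_n$ is connected in $\mathbb{R}^m\times[0,1]$ (the empty set counts as connected). *)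

theory Defs
  imports "HOL-Analysis.Analysis"
begin

section \<open>Hausdorff distance and Kuratowski convergence in a metric space\<close>

definition Hausdorff_pre :: "('a \<Rightarrow> 'a \<Rightarrow> real) \<Rightarrow> 'a set \<Rightarrow> 'a set \<Rightarrow> ennreal" where
  "Hausdorff_pre d U V = (SUP a\<in>U. INF b\<in>V. ennreal (d a b))"

definition Hausdorff_dist :: "('a \<Rightarrow> 'a \<Rightarrow> real) \<Rightarrow> 'a set \<Rightarrow> 'a set \<Rightarrow> ennreal" where
  "Hausdorff_dist d U V = max (Hausdorff_pre d U V) (Hausdorff_pre d V U)"

definition Kuratowski_liminf ::
    "'a set \<Rightarrow> ('a \<Rightarrow> 'a \<Rightarrow> real) \<Rightarrow> (nat \<Rightarrow> 'a set) \<Rightarrow> 'a set" where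
  "Kuratowski_liminf M d C =
     {l. \<exists>x. (\<forall>n. x n \<in> C n) \<and> limitin (Metric_space.mtopology M d) x l sequentially}"

definition Kuratowski_limsup ::
    "'a set \<Rightarrow> ('a \<Rightarrow> 'a \<Rightarrow> real) \<Rightarrow> (nat \<Rightarrow> 'a set) \<Rightarrow> 'a set" where
  "Kuratowski_limsup M d C =
     {l. \<exists>k x. strict_mono (k :: nat \<Rightarrow> nat) \<and> (\<forall>j. x j \<in> C (k j)) \<and>
           limitin (Metric_space.mtopology M d) x l sequentially}"

definition Kuratowski_converges ::
    "'a set \<Rightarrow> ('a \<Rightarrow> 'a \<Rightarrow> real) \<Rightarrow> (nat \<Rightarrow> 'a set) \<Rightarrow> 'a set \<Rightarrow> bool" where
  "Kuratowski_converges M d C L \<longleftrightarrow>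
     L = Kuratowski_liminf M d C \<and> L = Kuratowski_limsup M d C"

section \<open>The metric space of pairs (point, level)\<close>

text \<open>The metric below is not the library's \<open>dist\<close> on the product type, which is the
  Euclidean combination of the two distances.\<close>

definition level_space :: "((real ^ 'm) \<times> real) set" where
  "level_space = UNIV \<times> {0..1}"

definition level_dist :: "(real ^ 'm) \<times> real \<Rightarrow> (real ^ 'm) \<times> real \<Rightarrow> real" where
  "level_dist p q = dist (fst p) (fst q) + \<bar>snd p - snd q\<bar>"

lemma Metric_space_level: "Metric_space level_space level_dist"
proof
  fix x y z :: "(real ^ 'm) \<times> real"
  show "0 \<le> level_dist x y"
    by (simp add: level_dist_def)
  show "level_dist x y = level_dist y x"
    by (simp add: level_dist_def dist_commute abs_minus_commute)
  show "level_dist x y = 0 \<longleftrightarrow> x = y"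
    by (simp add: level_dist_def add_nonneg_eq_0_iff prod_eq_iff)
  show "level_dist x z \<le> level_dist x y + level_dist y z"
    using dist_triangle[of "fst x" "fst z" "fst y"] by (simp add: level_dist_def)
qed

section \<open>Fuzzy sets\<close>

text \<open>A fuzzy set is a real-valued function with values in \<open>{0..1}\<close>.\<close>

definition fuzzy_sets :: "(real ^ 'm \<Rightarrow> real) set" where
  "fuzzy_sets = {u. \<forall>x. u x \<in> {0..1}}"

definition fuzzy_cut :: "(real ^ 'm \<Rightarrow> real) \<Rightarrow> real \<Rightarrow> (real ^ 'm) set" where
  "fuzzy_cut u \<alpha> = (if \<alpha> = 0 then closure {x. u x > 0} else {x. u x \<ge> \<alpha>})"

definition fuzzy_empty :: "real ^ 'm \<Rightarrow> real" where
  "fuzzy_empty = (\<lambda>x. 0)"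

definition F_USC :: "(real ^ 'm \<Rightarrow> real) set" where
  "F_USC = {u \<in> fuzzy_sets. \<forall>\<alpha>\<in>{0..1}. closed (fuzzy_cut u \<alpha>)}"

definition F_USCG :: "(real ^ 'm \<Rightarrow> real) set" where
  "F_USCG = {u \<in> F_USC. \<forall>\<alpha>\<in>{0<..1}. compact (fuzzy_cut u \<alpha>)}"

definition endograph :: "(real ^ 'm \<Rightarrow> real) \<Rightarrow> ((real ^ 'm) \<times> real) set" where
  "endograph u = {(x, t) \<in> level_space. u x \<ge> t}"

definition endograph_above ::
    "real \<Rightarrow> (real ^ 'm \<Rightarrow> real) \<Rightarrow> ((real ^ 'm) \<times> real) set" where
  "endograph_above r u = endograph u \<inter> (fuzzy_cut u r \<times> {r..1})"

definition H_end :: "(real ^ 'm \<Rightarrow> real) \<Rightarrow> (real ^ 'm \<Rightarrow> real) \<Rightarrow> ennreal" where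
  "H_end u v = Hausdorff_dist level_dist (endograph u) (endograph v)"

definition Gamma_converges ::
    "(nat \<Rightarrow> real ^ 'm \<Rightarrow> real) \<Rightarrow> (real ^ 'm \<Rightarrow> real) \<Rightarrow> bool" where
  "Gamma_converges us u \<longleftrightarrow>
     Kuratowski_converges level_space level_dist (\<lambda>n. endograph (us n)) (endograph u)"

text \<open>The bound \<open>\<delta> \<le> 1\<close> is explicit because truncated endographs are only meant for levels
  in \<open>{0..1}\<close>. It does not change the condition: a \<open>\<delta>\<close> that works for \<open>min \<epsilon> 1\<close> works
  for \<open>\<epsilon>\<close>.\<close>

definition connectedness_condition :: "(nat \<Rightarrow> real ^ 'm \<Rightarrow> real) \<Rightarrow> bool" where
  "connectedness_condition us \<longleftrightarrow>
     (\<forall>\<epsilon>>0. \<exists>\<delta>\<in>{0<..\<epsilon>}. \<delta> \<le> 1 \<and>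
        (\<exists>N. \<forall>n\<ge>N. connectedin (Metric_space.mtopology level_space level_dist)
                     (endograph_above \<delta> (us n))))"

end

theory Submission
  imports Defs
begin

text \<open>Gamma-convergence controls the endographs uniformly on compact sets, so the only way for the
  Hausdorff distance not to tend to \<open>0\<close> is that points of \<open>end u\<^sub>n\<close> at levels above some \<open>\<delta> > 0\<close>
  escape to infinity. As \<open>u\<close> is nonzero, the sets \<open>end\<^sub>\<delta> u\<^sub>n\<close> also contain points that stay bounded.
  Being connected, they would then meet a fixed large sphere, outside the compact cut \<open>[u]\<^sub>\<delta>\<close>; a
  limit point there would lie in \<open>end u\<close>, a contradiction.\<close>

section \<open>Hausdorff distances tending to zero\<close>

lemma Hausdorff_pre_le:
  assumes "\<And>a. a \<in> U \<Longrightarrow> \<exists>b\<in>V. d a b \<le> e"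
  shows "Hausdorff_pre d U V \<le> ennreal e"
  unfolding Hausdorff_pre_def
proof (rule SUP_least)
  fix a assume "a \<in> U"
  then obtain b where b: "b \<in> V" "d a b \<le> e"
    using assms by blast
  show "(INF b\<in>V. ennreal (d a b)) \<le> ennreal e"
    by (rule INF_lower2[OF b(1)]) (simp add: b(2) ennreal_leI)
qed

text \<open>The infimum need not be attained; it is the strictness of the bound that yields an
  actual point of \<open>V\<close>.\<close>

lemma Hausdorff_pre_lessD:
  assumes "Hausdorff_pre d U V < ennreal e" "a \<in> U"
  shows "\<exists>b\<in>V. d a b < e"
proof -
  have "(INF b\<in>V. ennreal (d a b)) \<le> Hausdorff_pre d U V"
    unfolding Hausdorff_pre_def by (rule SUP_upper[OF assms(2)])
  then have "(INF b\<in>V. ennreal (d a b)) < ennreal e"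
    using assms(1) by order
  then obtain b where "b \<in> V" "ennreal (d a b) < ennreal e"
    by (auto simp: INF_less_iff)
  then show ?thesis
    by (meson ennreal_leI not_le)
qed

text \<open>This removes suprema and infima in \<open>ennreal\<close> from the rest of the proof and
  splits the distance into two one-sided eventual statements that can be treated separately.\<close>

lemma Hausdorff_dist_tendsto_0_iff:
  "((\<lambda>n. Hausdorff_dist d (C n) L) \<longlongrightarrow> 0) F \<longleftrightarrow>
     (\<forall>e>0. \<forall>\<^sub>F n in F. (\<forall>a\<in>C n. \<exists>b\<in>L. d a b < e) \<and> (\<forall>a\<in>L. \<exists>b\<in>C n. d a b < e))"
  (is "?lhs \<longleftrightarrow> ?rhs")
proof
  assume L: ?lhs
  show ?rhs
  proof (intro allI impI)
    fix e :: real assume "e > 0"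
    then have "\<forall>\<^sub>F n in F. Hausdorff_dist d (C n) L < ennreal e"
      by (intro order_tendstoD(2)[OF L]) simp
    then show "\<forall>\<^sub>F n in F. (\<forall>a\<in>C n. \<exists>b\<in>L. d a b < e) \<and> (\<forall>a\<in>L. \<exists>b\<in>C n. d a b < e)"
      by eventually_elim (auto simp: Hausdorff_dist_def dest: Hausdorff_pre_lessD)
  qed
next
  assume R: ?rhs
  show ?lhs
  proof (rule order_tendstoI)
    fix y :: ennreal assume "0 < y"
    \<comment> \<open>Nearby points at distance below \<open>e\<close> bound the supremum only
      weakly by \<open>e\<close>, so a level strictly below \<open>y\<close> is chosen first. Being
      below \<open>y\<close>, it is also finite.\<close>
    then obtain y' where y': "0 < y'" "y' < y"
      using dense by blast
    then obtain e where e: "y' = ennreal e" "e > 0"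
      by (cases y') auto
    have "\<forall>\<^sub>F n in F. Hausdorff_dist d (C n) L \<le> ennreal e"
      using R[rule_format, OF e(2)]
      by eventually_elim
        (auto simp: Hausdorff_dist_def intro!: Hausdorff_pre_le; meson less_imp_le)
    then show "\<forall>\<^sub>F n in F. Hausdorff_dist d (C n) L < y"
      by eventually_elim (use y' e in order)
  qed auto
qed

section \<open>The topology of the level space\<close>

lemma dist_le_level_dist: "dist p q \<le> level_dist p q"
  unfolding level_dist_def dist_prod_def dist_real_def
  by (rule order_trans[OF sqrt_sum_squares_le_sum_abs]) simp

lemma level_dist_le_dist: "level_dist p q \<le> 2 * dist p q"
  using dist_fst_le[of p q] dist_snd_le[of p q] by (simp add: level_dist_def dist_real_def)

text \<open>The two preceding bounds make \<open>level_dist\<close> and the product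
  \<open>dist\<close> equivalent, so the balls of either metric contain smaller balls of the other.
  Compactness, connectedness and limits can then be handled with the Euclidean type class.\<close>

lemma mtopology_level: "Metric_space.mtopology level_space level_dist = top_of_set level_space"
proof -
  interpret Metric_space level_space level_dist
    by (rule Metric_space_level)
  show ?thesis
  proof (rule topology_eq[THEN iffD2], rule allI)
    fix S :: "((real ^ 'a) \<times> real) set"
    have "(\<exists>r>0. mball x r \<subseteq> S) \<longleftrightarrow>
        (\<exists>e>0. \<forall>x'\<in>level_space. dist x' x < e \<longrightarrow> x' \<in> S)"
      if "S \<subseteq> level_space" "x \<in> S" for x
    proof
      assume "\<exists>r>0. mball x r \<subseteq> S"
      then obtain r where r: "r > 0" "mball x r \<subseteq> S" by blast
      \<comment> \<open>The radius is halved to absorb the factor 2 in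
        \<open>level_dist_le_dist\<close>.\<close>
      have "x' \<in> S" if x': "x' \<in> level_space" "dist x' x < r / 2" for x'
      proof -
        have "level_dist x x' < r"
          using x' level_dist_le_dist[of x x'] by (simp add: dist_commute)
        then show ?thesis
          using x' \<open>x \<in> S\<close> \<open>S \<subseteq> level_space\<close> by (intro subsetD[OF r(2)]) auto
      qed
      then show "\<exists>e>0. \<forall>x'\<in>level_space. dist x' x < e \<longrightarrow> x' \<in> S"
        using r(1) half_gt_zero by blast
    next
      assume "\<exists>e>0. \<forall>x'\<in>level_space. dist x' x < e \<longrightarrow> x' \<in> S"
      then obtain e where e: "e > 0" "\<And>x'. x' \<in> level_space \<Longrightarrow> dist x' x < e \<Longrightarrow> x' \<in> S"
        by blast
      have "mball x e \<subseteq> S"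
      proof
        fix x' assume "x' \<in> mball x e"
        then show "x' \<in> S"
          using e(2)[of x'] dist_le_level_dist[of x x'] by (auto simp: dist_commute)
      qed
      with e(1) show "\<exists>r>0. mball x r \<subseteq> S" by blast
    qed
    then show "openin mtopology S \<longleftrightarrow> openin (top_of_set level_space) S"
      unfolding openin_mtopology openin_euclidean_subtopology_iff by blast
  qed
qed

lemma closed_level_space: "closed level_space"
  unfolding level_space_def by (intro closed_Times) auto

text \<open>A limit in the subspace must itself belong to \<open>level_space\<close>; since that set
  is closed, an ordinary limit does so automatically.\<close>

lemma limitin_level_iff:
  assumes "\<And>n. x n \<in> level_space"
  shows "limitin (Metric_space.mtopology level_space level_dist) x l sequentially \<longleftrightarrow> x \<longlonglongrightarrow> l"
  using closed_sequentially[OF closed_level_space, of x l] assms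
  by (auto simp: mtopology_level limitin_subtopology)

section \<open>Endographs and Gamma-convergence\<close>

lemma endograph_subset: "endograph u \<subseteq> level_space"
  by (auto simp: endograph_def)

lemma endograph_iff: "p \<in> endograph u \<longleftrightarrow> snd p \<in> {0..1} \<and> snd p \<le> u (fst p)"
  by (auto simp: endograph_def level_space_def split: prod.splits)

lemma zero_level_in_endograph: "u \<in> fuzzy_sets \<Longrightarrow> (x, 0) \<in> endograph u"
  by (simp add: endograph_iff fuzzy_sets_def)

lemma closed_endograph:
  assumes "u \<in> F_USC"
  shows "closed (endograph u)"
  unfolding closed_sequential_limits
proof (intro allI impI)
  fix x l assume "(\<forall>n. x n \<in> endograph u) \<and> x \<longlonglongrightarrow> l"
  then have x: "\<And>n. x n \<in> endograph u" and lim: "x \<longlonglongrightarrow> l" by auto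
  have l: "snd l \<in> {0..1}"
    using closed_sequentially[OF closed_level_space subsetD[OF endograph_subset x] lim]
    by (auto simp: level_space_def)
  have "snd l \<le> u (fst l)"
  \<comment> \<open>The levels \<open>snd (x n)\<close> may approach \<open>snd l\<close> from
    below, so the cut at \<open>snd l\<close> itself need not contain any \<open>fst (x n)\<close>.
    For each smaller \<open>s > 0\<close> the closed cut at \<open>s\<close> eventually contains
    them, hence also the limit; for \<open>s\<close> at most 0 nonnegativity of \<open>u\<close>
    suffices.\<close>
  proof (rule dense_le)
    fix s assume s: "s < snd l"
    show "s \<le> u (fst l)"
    proof (cases "s > 0")
      case False
      then show ?thesis
        using assms by (auto simp: F_USC_def fuzzy_sets_def intro: order_trans[of _ 0])
    next
      case True
      then have "closed (fuzzy_cut u s)"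
        using assms s l by (auto simp: F_USC_def)
      moreover have "\<forall>\<^sub>F n in sequentially. fst (x n) \<in> fuzzy_cut u s"
        using order_tendstoD(1)[OF tendsto_snd[OF lim] s]
      proof eventually_elim
        case (elim n)
        then show ?case
          using x[of n] True by (simp add: endograph_iff fuzzy_cut_def)
      qed
      ultimately have "fst l \<in> fuzzy_cut u s"
        using Lim_in_closed_set[OF _ _ _ tendsto_fst[OF lim]] by simp
      then show ?thesis
        using True by (simp add: fuzzy_cut_def)
    qed
  qed
  with l show "l \<in> endograph u"
    by (simp add: endograph_iff)
qed

text \<open>The lower limit always lies in the upper limit, as the whole sequence is one of its own
  subsequences. The two equalities therefore reduce to two inclusions: \<open>endograph u\<close> in
  the lower limit, and the upper limit in \<open>endograph u\<close>.\<close>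

lemma Gamma_converges_iff:
  "Gamma_converges us u \<longleftrightarrow>
     (\<forall>p\<in>endograph u. \<exists>x. (\<forall>n. x n \<in> endograph (us n)) \<and> x \<longlonglongrightarrow> p) \<and>
     (\<forall>k x p. strict_mono k \<longrightarrow> (\<forall>j. x j \<in> endograph (us (k j))) \<longrightarrow> x \<longlonglongrightarrow> p \<longrightarrow> p \<in> endograph u)"
proof -
  have lim: "limitin (Metric_space.mtopology level_space level_dist) x p sequentially \<longleftrightarrow> x \<longlonglongrightarrow> p"
    if "\<forall>n. x n \<in> endograph (us (k n))" for x p k
    using that endograph_subset by (intro limitin_level_iff) blast
  have inf: "Kuratowski_liminf level_space level_dist (\<lambda>n. endograph (us n)) =
      {p. \<exists>x. (\<forall>n. x n \<in> endograph (us n)) \<and> x \<longlonglongrightarrow> p}"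
    unfolding Kuratowski_liminf_def using lim[of _ "\<lambda>n. n"] by (simp cong: conj_cong)
  have sup: "Kuratowski_limsup level_space level_dist (\<lambda>n. endograph (us n)) =
      {p. \<exists>k x. strict_mono k \<and> (\<forall>j. x j \<in> endograph (us (k j))) \<and> x \<longlonglongrightarrow> p}"
    unfolding Kuratowski_limsup_def using lim by (simp cong: conj_cong)
  have "{p. \<exists>x. (\<forall>n. x n \<in> endograph (us n)) \<and> x \<longlonglongrightarrow> p} \<subseteq>
      {p. \<exists>k x. strict_mono k \<and> (\<forall>j. x j \<in> endograph (us (k j))) \<and> x \<longlonglongrightarrow> p}"
    using strict_mono_id by (fastforce simp: id_def)
  then show ?thesis
    unfolding Gamma_converges_def Kuratowski_converges_def inf sup by blast
qed

section \<open>Uniform consequences of Kuratowski convergence on compact sets\<close>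

lemma eventually_disjoint_compact:
  fixes C :: "nat \<Rightarrow> 'a :: metric_space set"
  assumes sup: "\<And>k x p. strict_mono k \<Longrightarrow> (\<And>j. x j \<in> C (k j)) \<Longrightarrow> x \<longlonglongrightarrow> p \<Longrightarrow> p \<in> L"
    and "compact K" "K \<inter> L = {}"
  shows "\<forall>\<^sub>F n in sequentially. K \<inter> C n = {}"
proof (rule ccontr)
  assume "\<not> ?thesis"
  \<comment> \<open>If infinitely many \<open>C n\<close> meet \<open>K\<close>, points chosen there
    have a further subsequence converging in \<open>K\<close>. Its limit belongs to the upper limit,
    hence to \<open>L\<close>, against disjointness.\<close>
  then obtain k :: "nat \<Rightarrow> nat" where k: "strict_mono k" "\<And>n. K \<inter> C (k n) \<noteq> {}"
    by (auto dest!: not_eventually_sequentiallyD)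
  then have "\<forall>n. \<exists>x. x \<in> K \<and> x \<in> C (k n)"
    by blast
  then obtain x where x: "\<And>n. x n \<in> K" "\<And>n. x n \<in> C (k n)"
    by metis
  obtain l and r :: "nat \<Rightarrow> nat" where l: "l \<in> K" "strict_mono r" "(x \<circ> r) \<longlonglongrightarrow> l"
    using \<open>compact K\<close> x(1) unfolding compact_def by blast
  have "l \<in> L"
    by (rule sup[of "k \<circ> r" "x \<circ> r"]) (use k(1) l x in \<open>auto intro: strict_mono_o\<close>)
  with l assms(3) show False by blast
qed

text \<open>A finite \<open>e / 2\<close>-net of \<open>K\<close> turns the pointwise approximations
  into one that is uniform over \<open>K\<close>: only finitely many eventual statements have to
  hold at once.\<close>

lemma eventually_near_compact:
  fixes C :: "nat \<Rightarrow> 'a :: metric_space set"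
  assumes inf: "\<And>p. p \<in> K \<Longrightarrow> \<exists>x. (\<forall>n. x n \<in> C n) \<and> x \<longlonglongrightarrow> p"
    and "compact K" "e > 0"
  shows "\<forall>\<^sub>F n in sequentially. \<forall>p\<in>K. \<exists>q\<in>C n. dist p q < e"
proof -
  obtain T where T: "T \<subseteq> K" "finite T" "K \<subseteq> (\<Union>x\<in>T. ball x (e / 2))"
    using \<open>compact K\<close> \<open>e > 0\<close> seq_compact_imp_totally_bounded[of K]
    unfolding compact_eq_seq_compact_metric by (meson half_gt_zero)
  have "\<forall>\<^sub>F n in sequentially. \<exists>q\<in>C n. dist p q < e / 2" if p: "p \<in> T" for p
  proof -
    obtain x where x: "\<forall>n. x n \<in> C n" "x \<longlonglongrightarrow> p"
      using inf[of p] p T(1) by blast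
    have "\<forall>\<^sub>F n in sequentially. dist (x n) p < e / 2"
      using x(2) \<open>e > 0\<close> by (intro tendstoD) auto
    then show ?thesis
      by eventually_elim (use x(1) in \<open>auto simp: dist_commute\<close>)
  qed
  then have "\<forall>\<^sub>F n in sequentially. \<forall>p\<in>T. \<exists>q\<in>C n. dist p q < e / 2"
    using T(2) by (simp add: eventually_ball_finite)
  then show ?thesis
  proof eventually_elim
    case (elim n)
    show ?case
    proof
      fix p assume "p \<in> K"
      then obtain c where c: "c \<in> T" "dist c p < e / 2"
        using T(3) by auto
      then obtain q where "q \<in> C n" "dist c q < e / 2"
        using elim by blast
      then show "\<exists>q\<in>C n. dist p q < e"
        using c(2) dist_triangle_half_r by blast
    qed
  qed
qed

section \<open>From endograph distance to Gamma-convergence\<close>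

lemma H_end_tendsto_imp_Gamma:
  assumes "u \<in> F_USC" and lim: "(\<lambda>n. H_end (us n) u) \<longlonglongrightarrow> 0"
    and us: "\<And>n. us n \<in> F_USC"
  shows "Gamma_converges us u"
proof -
  note near = lim[unfolded H_end_def Hausdorff_dist_tendsto_0_iff, rule_format]
  have inf: "\<exists>x. (\<forall>n. x n \<in> endograph (us n)) \<and> x \<longlonglongrightarrow> p" if p: "p \<in> endograph u" for p
  proof -
    \<comment> \<open>Nearest points give one sequence that serves every \<open>e\<close>
      simultaneously. They exist because each endograph is closed and, containing level 0,
      nonempty.\<close>
    define D where "D n = infdist p (endograph (us n))" for n
    have ne: "endograph (us n) \<noteq> {}" for n
      using us[of n] zero_level_in_endograph[of "us n"] by (auto simp: F_USC_def)
    have "\<exists>x\<in>endograph (us n). D n = dist p x" for n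
      using infdist_attains_inf[OF closed_endograph[OF us] ne] unfolding D_def by metis
    then obtain x where x: "\<And>n. x n \<in> endograph (us n)" "\<And>n. D n = dist p (x n)"
      by metis
    have "x \<longlonglongrightarrow> p"
    proof (rule tendstoI)
      fix e :: real assume "e > 0"
      from near[OF this] show "\<forall>\<^sub>F n in sequentially. dist (x n) p < e"
      proof eventually_elim
        case (elim n)
        then obtain q where q: "q \<in> endograph (us n)" "level_dist p q < e"
          using p by blast
        have "D n \<le> dist p q"
          unfolding D_def by (rule infdist_le[OF q(1)])
        then show ?case
          using q(2) dist_le_level_dist[of p q] x(2)[of n] by (simp add: dist_commute)
      qed
    qed
    with x(1) show ?thesis by blast
  qed
  have sup: "p \<in> endograph u"
    if k: "strict_mono k" and x: "\<And>j. x j \<in> endograph (us (k j))" and p: "x \<longlonglongrightarrow> p" for k x p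
  proof -
    \<comment> \<open>As \<open>endograph u\<close> is closed, arbitrarily close approximation of
      \<open>p\<close> is enough: \<open>x j\<close> serves as an intermediate point, within
      \<open>e / 2\<close> of both \<open>p\<close> and \<open>endograph u\<close>.\<close>
    have "\<exists>q\<in>endograph u. dist q p < e" if "e > 0" for e
    proof -
      have "\<forall>\<^sub>F j in sequentially. \<forall>a\<in>endograph (us (k j)). \<exists>b\<in>endograph u. level_dist a b < e / 2"
        using eventually_subseq[OF k near[of "e / 2"]] \<open>e > 0\<close> by (auto elim: eventually_mono)
      moreover have "\<forall>\<^sub>F j in sequentially. dist (x j) p < e / 2"
        using p \<open>e > 0\<close> by (intro tendstoD) auto
      ultimately have "\<forall>\<^sub>F j in sequentially. \<exists>q\<in>endograph u. dist q p < e"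
      proof eventually_elim
        case (elim j)
        then obtain q where q: "q \<in> endograph u" "level_dist (x j) q < e / 2"
          using x by blast
        then have "dist (x j) q < e / 2"
          by (intro le_less_trans[OF dist_le_level_dist])
        with elim(2) q(1) show ?case
          using dist_triangle_half_r by blast
      qed
      then show ?thesis by simp
    qed
    then show ?thesis
      using closed_approachable[OF closed_endograph[OF \<open>u \<in> F_USC\<close>]] by blast
  qed
  show ?thesis
    unfolding Gamma_converges_iff using inf sup by blast
qed

section \<open>Truncated endographs and their boundedness\<close>

lemma compact_endograph_above:
  assumes "u \<in> F_USCG" "0 < r" "r \<le> 1"
  shows "compact (endograph_above r u)"
proof -
  have "compact (fuzzy_cut u r \<times> {r..1})" "closed (endograph u)"
    using assms by (auto simp: F_USCG_def intro: compact_Times closed_endograph)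
  then show ?thesis
    unfolding endograph_above_def by (simp add: closed_Int_compact)
qed

text \<open>For positive \<open>r\<close> the cut condition follows from
  \<open>r \<le> snd p \<le> u (fst p)\<close>; at level 0 the cut is a closure instead.\<close>

lemma endograph_above_iff:
  assumes "0 < r"
  shows "p \<in> endograph_above r u \<longleftrightarrow> p \<in> endograph u \<and> r \<le> snd p"
  using assms by (cases p) (auto simp: endograph_above_def endograph_iff fuzzy_cut_def)

text \<open>The norm of the first component maps the connected set
  \<open>endograph_above \<delta> (us n)\<close> onto an interval. Eventually this interval has a
  member below \<open>R\<close> but omits \<open>R\<close>, so it stays below
  \<open>R\<close>.\<close>

lemma eventually_endograph_above_bounded:
  fixes u :: "real ^ 'm \<Rightarrow> real"
  assumes u: "u \<in> F_USCG" and "\<delta> > 0" "\<delta> < u x0"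
    and gamma: "Gamma_converges us u"
    and conn: "\<forall>\<^sub>F n in sequentially.
      connectedin (Metric_space.mtopology level_space level_dist) (endograph_above \<delta> (us n))"
  shows "\<exists>R. \<forall>\<^sub>F n in sequentially. endograph_above \<delta> (us n) \<subseteq> cball 0 R \<times> {\<delta>..1}"
proof -
  note gamma = gamma[unfolded Gamma_converges_iff]
  have u01: "u x \<in> {0..1}" for x
    using u by (auto simp: F_USCG_def F_USC_def fuzzy_sets_def)
  have "\<delta> \<le> 1"
    using u01[of x0] \<open>\<delta> < u x0\<close> by simp
  then have "bounded (fuzzy_cut u \<delta>)"
    using u \<open>\<delta> > 0\<close> by (auto simp: F_USCG_def compact_imp_bounded)
  then obtain B where B: "\<And>x. x \<in> fuzzy_cut u \<delta> \<Longrightarrow> norm x \<le> B"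
    by (auto simp: bounded_iff)
  \<comment> \<open>The margin 1 places the sphere of radius \<open>R\<close> strictly outside the
    cut at \<open>\<delta>\<close>, while \<open>x0\<close>, which lies in that cut, is strictly
    inside.\<close>
  define R where "R = B + 1"
  have x0: "norm x0 < R"
    using B[of x0] \<open>\<delta> > 0\<close> \<open>\<delta> < u x0\<close> by (simp add: fuzzy_cut_def R_def)
  have "compact (sphere (0 :: real ^ 'm) R \<times> {\<delta>..1})"
    by (intro compact_Times compact_sphere compact_Icc)
  moreover have "(sphere 0 R \<times> {\<delta>..1}) \<inter> endograph u = {}"
  proof -
    have "norm (fst p) \<noteq> R" if "p \<in> endograph u" "\<delta> \<le> snd p" for p
      using B[of "fst p"] that \<open>\<delta> > 0\<close> by (auto simp: endograph_iff fuzzy_cut_def R_def)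
    then show ?thesis
      by fastforce
  qed
  ultimately have sphere:
    "\<forall>\<^sub>F n in sequentially. (sphere 0 R \<times> {\<delta>..1}) \<inter> endograph (us n) = {}"
    using gamma by (intro eventually_disjoint_compact[where L = "endograph u"]) blast+
  \<comment> \<open>The lower limit supplies points \<open>y n\<close> near
    \<open>(x0, u x0)\<close>. Because \<open>\<delta> < u x0\<close> and \<open>norm x0 < R\<close>
    are strict, they eventually lie in the truncated endograph and inside the sphere.\<close>
  have "(x0, u x0) \<in> endograph u"
    using u01 by (simp add: endograph_iff)
  then obtain y where y: "\<And>n. y n \<in> endograph (us n)" "y \<longlonglongrightarrow> (x0, u x0)"
    using gamma by blast
  have "\<forall>\<^sub>F n in sequentially. \<delta> < snd (y n)"
    using tendsto_snd[OF y(2)] \<open>\<delta> < u x0\<close> by (intro order_tendstoD) auto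
  moreover have "\<forall>\<^sub>F n in sequentially. norm (fst (y n)) < R"
    using tendsto_norm[OF tendsto_fst[OF y(2)]] x0 by (intro order_tendstoD) auto
  ultimately have "\<forall>\<^sub>F n in sequentially. endograph_above \<delta> (us n) \<subseteq> cball 0 R \<times> {\<delta>..1}"
    using sphere conn
  proof eventually_elim
    case (elim n)
    have yn: "y n \<in> endograph_above \<delta> (us n)"
      using elim y(1) \<open>\<delta> > 0\<close> by (simp add: endograph_above_iff)
    have "connected (endograph_above \<delta> (us n))"
      using elim(4) unfolding mtopology_level connectedin_subtopology by simp
    then have "connected ((\<lambda>p. norm (fst p)) ` endograph_above \<delta> (us n))"
      by (intro connected_continuous_image continuous_intros)
    then have ivl: "is_interval ((\<lambda>p. norm (fst p)) ` endograph_above \<delta> (us n))"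
      by (simp add: is_interval_connected_1)
    have "norm (fst p) \<le> R" if p: "p \<in> endograph_above \<delta> (us n)" for p
    proof (rule ccontr)
      assume "\<not> norm (fst p) \<le> R"
      then have "R \<in> (\<lambda>p. norm (fst p)) ` endograph_above \<delta> (us n)"
        using ivl yn p elim(2) unfolding is_interval_1
        by (meson image_eqI less_imp_le not_le)
      then obtain q where "q \<in> endograph_above \<delta> (us n)" "norm (fst q) = R"
        by auto
      then have "q \<in> (sphere 0 R \<times> {\<delta>..1}) \<inter> endograph (us n)"
        by (cases q) (auto simp: endograph_above_def)
      with elim(3) show False by blast
    qed
    then show ?case
      by (fastforce simp: endograph_above_def)
  qed
  then show ?thesis by blast
qed

section \<open>From Gamma-convergence to endograph distance\<close>

lemma open_level_dist_less: "open {p. level_dist p q < e}"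
  unfolding level_dist_def by (intro open_Collect_less continuous_intros)

text \<open>The part of \<open>endograph u\<close> above a small level \<open>r\<close> is compact
  and is approximated uniformly. A point below that level is simply dropped to level 0, which lies
  in every endograph and costs less than \<open>r\<close>.\<close>

lemma Gamma_imp_eventually_endograph_near:
  assumes u: "u \<in> F_USCG" and us: "\<And>n. us n \<in> F_USC"
    and gamma: "Gamma_converges us u" and "e > 0"
  shows "\<forall>\<^sub>F n in sequentially. \<forall>a\<in>endograph u. \<exists>b\<in>endograph (us n). level_dist a b < e"
proof -
  \<comment> \<open>Halving gives \<open>r < e\<close>, and the cap at 1 keeps \<open>r\<close> in
    the range where cuts of \<open>u\<close> are compact. The separate bound \<open>e / 2\<close> on
    \<open>dist\<close> below pays for passing to \<open>level_dist\<close>.\<close>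
  define r where "r = min (e / 2) 1"
  have r: "0 < r" "r \<le> 1" "r < e"
    using \<open>e > 0\<close> by (auto simp: r_def)
  have "\<forall>\<^sub>F n in sequentially. \<forall>p\<in>endograph_above r u. \<exists>q\<in>endograph (us n). dist p q < e / 2"
  proof (rule eventually_near_compact)
    show "compact (endograph_above r u)"
      using u r by (intro compact_endograph_above)
  qed (use gamma \<open>e > 0\<close> r in \<open>auto simp: Gamma_converges_iff endograph_above_iff\<close>)
  then show ?thesis
  proof eventually_elim
    case (elim n)
    show ?case
    proof
      fix a assume a: "a \<in> endograph u"
      show "\<exists>b\<in>endograph (us n). level_dist a b < e"
      proof (cases "r \<le> snd a")
        case True
        then obtain b where "b \<in> endograph (us n)" "dist a b < e / 2"
          using elim a endograph_above_iff[OF r(1)] by blast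
        then show ?thesis
          using level_dist_le_dist[of a b] by (intro bexI[of _ b]) auto
      next
        case False
        then show ?thesis
          using a us[of n] r
          by (intro bexI[of _ "(fst a, 0)"])
            (auto simp: level_dist_def endograph_iff F_USC_def fuzzy_sets_def)
      qed
    qed
  qed
qed

text \<open>Points of \<open>endograph (us n)\<close> below level \<open>\<delta>\<close> are
  dropped to level 0 of \<open>endograph u\<close>. Those above it eventually lie in a fixed compact
  box, where the upper limit controls them.\<close>

lemma Gamma_imp_eventually_near_endograph:
  assumes u: "u \<in> F_USCG" "u \<noteq> fuzzy_empty"
    and conn: "connectedness_condition us"
    and gamma: "Gamma_converges us u" and "e > 0"
  shows "\<forall>\<^sub>F n in sequentially. \<forall>a\<in>endograph (us n). \<exists>b\<in>endograph u. level_dist a b < e"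
proof -
  have fuzzy: "u \<in> fuzzy_sets"
    using u by (auto simp: F_USCG_def F_USC_def)
  obtain x0 where "u x0 \<noteq> 0"
    using u(2) by (auto simp: fuzzy_empty_def)
  then have x0: "u x0 > 0"
    using fuzzy by (simp add: fuzzy_sets_def less_le)
  \<comment> \<open>Both bounds pass to \<open>\<delta>\<close>: being below \<open>e\<close> makes
    dropping to level 0 cheap, and being below \<open>u x0\<close> is what the boundedness lemma
    requires.\<close>
  define \<epsilon> where "\<epsilon> = min e (u x0) / 2"
  have "\<epsilon> > 0" "\<epsilon> < e" "\<epsilon> < u x0"
    using x0 \<open>e > 0\<close> by (auto simp: \<epsilon>_def min_def)
  then obtain \<delta> N where \<delta>: "0 < \<delta>" "\<delta> < e" "\<delta> < u x0"
    and N: "\<And>n. n \<ge> N \<Longrightarrow>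
      connectedin (Metric_space.mtopology level_space level_dist) (endograph_above \<delta> (us n))"
    using conn unfolding connectedness_condition_def
    by (metis greaterThanAtMost_iff order.strict_trans1)
  obtain R where R: "\<forall>\<^sub>F n in sequentially. endograph_above \<delta> (us n) \<subseteq> cball 0 R \<times> {\<delta>..1}"
    using eventually_endograph_above_bounded[OF u(1) \<delta>(1,3) gamma] N
    by (auto simp: eventually_sequentially)
  \<comment> \<open>\<open>W\<close> is the open \<open>e\<close>-neighbourhood of
    \<open>endograph u\<close> for \<open>level_dist\<close>. Removing it from the box leaves a
    compact set disjoint from \<open>endograph u\<close>, which the endographs of
    \<open>us n\<close> must eventually miss.\<close>
  define W where "W = (\<Union>q\<in>endograph u. {p. level_dist p q < e})"
  have "open W"
    unfolding W_def by (intro open_UN ballI open_level_dist_less)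
  then have "compact (cball 0 R \<times> {\<delta>..1} - W)"
    by (intro compact_diff compact_Times) auto
  moreover have "(cball 0 R \<times> {\<delta>..1} - W) \<inter> endograph u = {}"
    using \<open>e > 0\<close> by (fastforce simp: W_def level_dist_def)
  ultimately have "\<forall>\<^sub>F n in sequentially. (cball 0 R \<times> {\<delta>..1} - W) \<inter> endograph (us n) = {}"
    using gamma[unfolded Gamma_converges_iff]
    by (intro eventually_disjoint_compact[where L = "endograph u"]) blast+
  with R show ?thesis
  proof eventually_elim
    case (elim n)
    show ?case
    proof
      fix a assume a: "a \<in> endograph (us n)"
      show "\<exists>b\<in>endograph u. level_dist a b < e"
      proof (cases "\<delta> \<le> snd a")
        case True
        then have "a \<in> cball 0 R \<times> {\<delta>..1}"
          using elim(1) a \<delta>(1) by (auto simp: endograph_above_iff)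
        then have "a \<in> W"
          using elim(2) a by blast
        then show ?thesis
          by (auto simp: W_def)
      next
        case False
        then show ?thesis
          using a \<delta> zero_level_in_endograph[OF fuzzy, of "fst a"]
          by (intro bexI[of _ "(fst a, 0)"]) (auto simp: level_dist_def endograph_iff)
      qed
    qed
  qed
qed

theorem theorem5p10:
  fixes u :: "real ^ 'm \<Rightarrow> real"
    and us :: "nat \<Rightarrow> real ^ 'm \<Rightarrow> real"
  assumes "u \<in> F_USCG - {fuzzy_empty}"
    and "\<And>n. us n \<in> F_USC"
    and "connectedness_condition us"
  shows "((\<lambda>n. H_end (us n) u) \<longlonglongrightarrow> 0) \<longleftrightarrow> Gamma_converges us u"
proof
  assume "(\<lambda>n. H_end (us n) u) \<longlonglongrightarrow> 0"
  then show "Gamma_converges us u"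
    using assms by (intro H_end_tendsto_imp_Gamma) (auto simp: F_USCG_def)
next
  assume gamma: "Gamma_converges us u"
  have u: "u \<in> F_USCG" "u \<noteq> fuzzy_empty"
    using assms(1) by auto
  show "(\<lambda>n. H_end (us n) u) \<longlonglongrightarrow> 0"
    unfolding H_end_def Hausdorff_dist_tendsto_0_iff
    using Gamma_imp_eventually_endograph_near[OF u(1) assms(2) gamma]
      Gamma_imp_eventually_near_endograph[OF u assms(3) gamma]
    by (intro allI impI eventually_conj)
qed

end
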